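(* Let $\mathcal{C}$ be a property of rings such that a ring $A$ has property $\mathcal{C}$ if and only if every prime factor of $A$ has property $\mathcal{C}$. Let $T$ be a ring, let $R$ be a subring of $T$, put $\mathcal{E}_{\mathcal{P}}=\{e=e^2\in T \mid e+\mathcal{P}(T) \text{ is central in } T/\mathcal{P}(T)\}$, let $\emptyset\neq\mathcal{E}\subseteq\mathcal{E}_{\mathcal{P}}$, and let $S=\langle R\cup\mathcal{E}\rangle_T$ be the subring of $T$ generated by $R\cup\mathcal{E}$. Then $R$ has property $\mathcal{C}$ if and only if $S$ has property $\mathcal{C}$. In particular, $R$ is strongly $\pi$-regular if and only if $S$ is strongly $\pi$-regular.
   Context: All rings are associative with unity; subrings contain the unity of the overring; properties of rings are understood to be invariant under ring isomorphism. $\mathcal{P}(T)$ denotes the prime radical of $T$ (the intersection of all prime ideals). A prime factor of a ring $A$ is a factor ring $A/P$ with $P$ a prime ideal of $A$. A ring $A$ is strongly $\pi$-regular if for each $x\in A$ there is a positive integer $n$ (depending on $x$) with $x^n\in x^{n+1}A$. *)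

theory Defs
  imports
    "HOL-Algebra.Ideal_Product"
    "HOL-Algebra.Generated_Rings"
    "HOL-Algebra.Weak_Morphisms"
begin

text \<open>
  The library locale \<^locale>\<open>primeideal\<close> is restricted to commutative rings and is
  element-wise (\<open>a b \<in> P\<close> implies \<open>a \<in> P\<close> or \<open>b \<in> P\<close>).
  For general associative rings primeness is the condition on products of two-sided ideals.
\<close>

definition prime_ideal :: "('a, 'm) ring_scheme \<Rightarrow> 'a set \<Rightarrow> bool" where
  "prime_ideal A P \<longleftrightarrow>
     ideal P A \<and> P \<noteq> carrier A \<and>
     (\<forall>I J. ideal I A \<longrightarrow> ideal J A \<longrightarrow> ideal_prod A I J \<subseteq> P \<longrightarrow> I \<subseteq> P \<or> J \<subseteq> P)"

text \<open>Intersecting with the carrier makes the prime radical of the zero ring the whole ring.\<close>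

definition prime_radical :: "('a, 'm) ring_scheme \<Rightarrow> 'a set" where
  "prime_radical A = carrier A \<inter> \<Inter> {P. prime_ideal A P}"

definition central :: "('a, 'm) ring_scheme \<Rightarrow> 'a \<Rightarrow> bool" where
  "central A z \<longleftrightarrow> z \<in> carrier A \<and> (\<forall>a \<in> carrier A. z \<otimes>\<^bsub>A\<^esub> a = a \<otimes>\<^bsub>A\<^esub> z)"

definition idempotents_central_mod_prime_radical :: "('a, 'm) ring_scheme \<Rightarrow> 'a set" where
  "idempotents_central_mod_prime_radical T =
     {e \<in> carrier T. e \<otimes>\<^bsub>T\<^esub> e = e \<and>
        central (T Quot prime_radical T) (prime_radical T +>\<^bsub>T\<^esub> e)}"

definition strongly_pi_regular :: "('a, 'm) ring_scheme \<Rightarrow> bool" where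
  "strongly_pi_regular A \<longleftrightarrow>
     (\<forall>x \<in> carrier A. \<exists>n::nat. n > 0 \<and>
        x [^]\<^bsub>A\<^esub> n \<in> x [^]\<^bsub>A\<^esub> (n + 1) <#\<^bsub>A\<^esub> carrier A)"

definition iso_invariant :: "('a ring \<Rightarrow> bool) \<Rightarrow> bool" where
  "iso_invariant \<C> \<longleftrightarrow>
     (\<forall>A B. ring A \<longrightarrow> ring B \<longrightarrow> A \<simeq> B \<longrightarrow> (\<C> A \<longleftrightarrow> \<C> B))"

text \<open>
  A property of rings is a predicate \<open>\<C>\<close> on the rings over one type \<open>'a\<close>, while the
  factor rings of such a ring live over \<open>'a set\<close>. Being isomorphism invariant, \<open>\<C>\<close>
  extends to every ring that is isomorphic to one over \<open>'a\<close>. The lemmas below show that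
  this covers all factor rings of rings over \<open>'a\<close>, that the choice of the isomorphic copy
  is immaterial, and that nothing changes for rings over \<open>'a\<close> itself.
\<close>

definition has_property :: "('a ring \<Rightarrow> bool) \<Rightarrow> 'b ring \<Rightarrow> bool" where
  "has_property \<C> B \<longleftrightarrow> (\<exists>A. ring A \<and> A \<simeq> B \<and> \<C> A)"

definition determined_by_prime_factors :: "('a ring \<Rightarrow> bool) \<Rightarrow> bool" where
  "determined_by_prime_factors \<C> \<longleftrightarrow>
     (\<forall>A. ring A \<longrightarrow> (\<C> A \<longleftrightarrow> (\<forall>P. prime_ideal A P \<longrightarrow> has_property \<C> (A Quot P))))"

lemma factor_ring_has_copy:
  fixes A :: "'a ring"
  assumes "ideal I A"
  shows "\<exists>B :: 'a ring. ring B \<and> B \<simeq> A Quot I"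
proof -
  interpret ideal I A by (rule assms)
  interpret Q: ring "A Quot I" by (rule quotient_is_ring)
  define f :: "'a set \<Rightarrow> 'a" where "f = (\<lambda>X. SOME x. x \<in> X)"
  have mem: "f X \<in> X" if "X \<in> carrier (A Quot I)" for X
  proof -
    have "\<exists>x. x \<in> X"
      using that a_rcos_self unfolding FactRing_def A_RCOSETS_def' by auto
    then show ?thesis unfolding f_def by (rule someI_ex)
  qed
  have inj: "inj_on f (carrier (A Quot I))"
  proof (rule inj_onI)
    fix X Y assume X: "X \<in> carrier (A Quot I)" and Y: "Y \<in> carrier (A Quot I)" and "f X = f Y"
    then have "f X \<in> X \<inter> Y" using mem[OF X] mem[OF Y] by simp
    then show "X = Y"
      using X Y a_rcos_disjoint unfolding FactRing_def pairwise_def disjnt_def by auto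
  qed
  have "ring (image_ring f (A Quot I))"
    using Q.inj_imp_image_ring_is_ring[OF inj] .
  moreover have "A Quot I \<simeq> image_ring f (A Quot I)"
    using inj_imp_image_ring_iso[OF inj] unfolding is_ring_iso_def by blast
  ultimately show ?thesis using ring_iso_sym[OF Q.ring_axioms] by blast
qed

lemma has_property_iff:
  fixes \<C> :: "'a ring \<Rightarrow> bool"
  assumes "iso_invariant \<C>" "ring B" "ring A" "A \<simeq> B"
  shows "has_property \<C> B \<longleftrightarrow> \<C> A"
proof
  assume "has_property \<C> B"
  then obtain A' where A': "ring A'" "A' \<simeq> B" "\<C> A'" unfolding has_property_def by blast
  have "A' \<simeq> A" using ring_iso_trans[OF A'(2) ring_iso_sym[OF assms(3,4)]] .
  then show "\<C> A" using assms(1,3) A' unfolding iso_invariant_def by blast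
qed (use assms in \<open>auto simp: has_property_def\<close>)

lemma has_property_same_type:
  fixes \<C> :: "'a ring \<Rightarrow> bool"
  assumes "iso_invariant \<C>" "ring A"
  shows "has_property \<C> A \<longleftrightarrow> \<C> A"
  using has_property_iff[OF assms assms(2) ring_iso_refl] .

end

theory Submission
  imports
    Defs
    "HOL-Algebra.Ring_Divisibility"
begin

text \<open>
  Write \<open>A\<close> for the given subring, \<open>S\<close> for the subring generated by \<open>A\<close> and the idempotents.
  The point is that \<open>A\<close> and \<open>S\<close> have the same prime factor rings up to isomorphism.

  Every prime ideal \<open>K\<close> of \<open>S\<close> contains the part of the prime radical of the overring that lies
  in \<open>S\<close>: by \<open>exists_prime_ideal_contracting_into\<close> some prime ideal \<open>Q\<close> of the overring satisfies
  \<open>Q \<inter> S \<subseteq> K\<close>. Hence each of the given idempotents becomes a central idempotent in \<open>S/K\<close>, and a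
  central idempotent of a prime ring is \<open>0\<close> or \<open>1\<close>
  (\<open>idempotent_central_mod_prime\<close>). So the adjoined elements contribute nothing new modulo \<open>K\<close>, that
  is \<open>S = A + K\<close> (\<open>subring_eq_sum_with_prime\<close>), whence \<open>A/(K \<inter> A) \<cong> S/K\<close> and \<open>K \<inter> A\<close> is prime in
  \<open>A\<close>. This carries a property determined by prime factors from \<open>A\<close> to \<open>S\<close>.

  For the converse each prime ideal \<open>P\<close> of \<open>A\<close> must be such a contraction (\<open>lying_over\<close>). Take an
  ideal \<open>Q\<close> of \<open>S\<close> maximal with \<open>Q \<inter> A \<subseteq> P\<close>; it is prime, so \<open>S = A + Q\<close>. But then \<open>P + Q\<close> is an
  ideal of \<open>S\<close>, and by the modular law it still meets \<open>A\<close> inside \<open>P\<close>; maximality gives \<open>P \<subseteq> Q\<close>.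

  Strong \<open>\<pi>\<close>-regularity is an instance because it is determined by prime factors, a result of Fisher
  and Snider: if no power \<open>x\<^sup>n\<close> lies in \<open>x\<^sup>n\<^sup>+\<^sup>1A\<close>, then an ideal maximal among those modulo which this
  failure persists is prime.

  Both appeals to maximality, for \<open>Q\<close> and for the failing power, are the same argument: an ideal maximal
  among those disjoint from a set \<open>D\<close> is prime as soon as products of ideals meeting \<open>D\<close> meet \<open>D\<close>
  (\<open>exists_prime_ideal_avoiding\<close>).
\<close>

section \<open>Prime ideals of noncommutative rings\<close>

lemma mem_set_add_iff:
  fixes R (structure)
  shows "x \<in> A <+>\<^bsub>R\<^esub> B \<longleftrightarrow> (\<exists>a \<in> A. \<exists>b \<in> B. x = a \<oplus> b)"
  unfolding set_add_def' by blast

text \<open>In a unital ring additive inverses are multiples by \<open>- 1\<close>, so they need no separate check.\<close>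

lemma (in ring) idealI_closed:
  assumes "I \<subseteq> carrier R" "\<zero> \<in> I"
    and add: "\<And>a b. a \<in> I \<Longrightarrow> b \<in> I \<Longrightarrow> a \<oplus> b \<in> I"
    and l: "\<And>a x. a \<in> I \<Longrightarrow> x \<in> carrier R \<Longrightarrow> x \<otimes> a \<in> I"
    and r: "\<And>a x. a \<in> I \<Longrightarrow> x \<in> carrier R \<Longrightarrow> a \<otimes> x \<in> I"
  shows "ideal I R"
proof (rule idealI[OF ring_axioms])
  have neg: "\<ominus> a \<in> I" if "a \<in> I" for a
    using l[OF that, of "\<ominus> \<one>"] that assms(1) by (auto simp: l_minus)
  show "subgroup I (add_monoid R)"
    by (rule add.subgroupI) (use assms neg in \<open>auto simp: a_inv_def\<close>)
qed (use l r in auto)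

text \<open>
  This passes between the ideal-wise condition, which maximal ideals satisfy by their maximality,
  and elements, which move freely between a ring and its subrings. If \<open>a r b \<in> P\<close> for all \<open>r\<close>, the ideals to
  multiply are the annihilators modulo \<open>P\<close> used in the proof, rather than the ideals
  generated by \<open>a\<close> and \<open>b\<close>: membership in them is explicit.
\<close>

lemma (in ring) prime_ideal_iff:
  "prime_ideal R P \<longleftrightarrow> ideal P R \<and> P \<noteq> carrier R \<and>
     (\<forall>a \<in> carrier R. \<forall>b \<in> carrier R. (\<forall>r \<in> carrier R. a \<otimes> r \<otimes> b \<in> P) \<longrightarrow> a \<in> P \<or> b \<in> P)"
    (is "_ \<longleftrightarrow> _ \<and> _ \<and> ?elementwise")
proof (cases "ideal P R")
  case True
  then interpret P: ideal P R .
  have ?elementwise if prime: "prime_ideal R P"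
  proof (intro ballI impI)
    fix a b assume a: "a \<in> carrier R" and b: "b \<in> carrier R"
      and aRb: "\<forall>r \<in> carrier R. a \<otimes> r \<otimes> b \<in> P"
    define I where "I = {x \<in> carrier R. \<forall>r \<in> carrier R. x \<otimes> r \<otimes> b \<in> P}"
    define J where "J = {y \<in> carrier R. \<forall>x \<in> I. \<forall>r \<in> carrier R. x \<otimes> r \<otimes> y \<in> P}"
    have I: "ideal I R"
    proof (rule idealI_closed)
      fix x y assume xy: "x \<in> I" "y \<in> carrier R"
      have "x \<otimes> y \<otimes> r \<otimes> b = x \<otimes> (y \<otimes> r) \<otimes> b" "y \<otimes> x \<otimes> r \<otimes> b = y \<otimes> (x \<otimes> r \<otimes> b)"
        if "r \<in> carrier R" for r
        using xy b that by (auto simp: I_def m_assoc)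
      then show "x \<otimes> y \<in> I" "y \<otimes> x \<in> I"
        using xy by (auto simp: I_def P.I_l_closed)
    qed (use b in \<open>auto simp: I_def l_distr P.a_closed\<close>)
    have I_car: "x \<in> carrier R" if "x \<in> I" for x using that by (simp add: I_def)
    have J: "ideal J R"
    proof (rule idealI_closed)
      fix x y assume xy: "x \<in> J" "y \<in> carrier R"
      show "x \<otimes> y \<in> J"
        using xy I_car P.I_r_closed[of _ y] by (auto simp: J_def m_assoc[symmetric])
      have "z \<otimes> r \<otimes> (y \<otimes> x) = z \<otimes> (r \<otimes> y) \<otimes> x" if "z \<in> I" "r \<in> carrier R" for z r
        using xy I_car that by (auto simp: J_def m_assoc)
      then show "y \<otimes> x \<in> J"
        using xy by (auto simp: J_def)
    qed (use I_car in \<open>auto simp: J_def r_distr P.a_closed\<close>)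
    have "ideal_prod R I J \<subseteq> P"
    proof
      fix z assume "z \<in> ideal_prod R I J"
      then show "z \<in> P"
      proof induction
        case (prod x y)
        then have "x \<otimes> \<one> \<otimes> y \<in> P" unfolding J_def by blast
        then show ?case using prod I_car by simp
      qed (rule P.a_closed)
    qed
    moreover have "a \<in> I" "b \<in> J" using a b aRb by (auto simp: I_def J_def)
    ultimately show "a \<in> P \<or> b \<in> P"
      using prime I J unfolding prime_ideal_def by blast
  qed
  moreover have "I \<subseteq> P \<or> J \<subseteq> P"
    if ?elementwise "ideal I R" "ideal J R" "ideal_prod R I J \<subseteq> P" for I J
  proof (rule ccontr)
    assume "\<not> (I \<subseteq> P \<or> J \<subseteq> P)"
    then obtain a b where ab: "a \<in> I" "a \<notin> P" "b \<in> J" "b \<notin> P" by blast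
    have "a \<otimes> r \<otimes> b \<in> P" if "r \<in> carrier R" for r
      using ab that \<open>ideal_prod R I J \<subseteq> P\<close> \<open>ideal I R\<close>
      by (meson ideal.I_r_closed ideal_prod.prod subsetD)
    then show False
      using that(1) ab ideal.Icarr[OF that(2)] ideal.Icarr[OF that(3)] by blast
  qed
  ultimately show ?thesis using True unfolding prime_ideal_def by blast
qed (simp add: prime_ideal_def)

text \<open>
  The noncommutative form of the fact that ideals maximal with respect to avoiding a multiplicative
  set are prime. If \<open>I\<close> and \<open>J\<close> are not contained in the maximal ideal \<open>P\<close>, then \<open>I + P\<close> and \<open>J + P\<close> meet \<open>D\<close>, so
  their product does; were \<open>I J \<subseteq> P\<close>, this product would lie in \<open>P\<close>. Maximality is exported as well, since
  \<open>lying_over\<close> uses it a second time.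
\<close>

lemma (in ring) exists_prime_ideal_avoiding:
  assumes "\<zero> \<notin> D" "D \<inter> carrier R \<noteq> {}"
    and prod: "\<And>I J. ideal I R \<Longrightarrow> ideal J R \<Longrightarrow> I \<inter> D \<noteq> {} \<Longrightarrow> J \<inter> D \<noteq> {} \<Longrightarrow>
       ideal_prod R I J \<inter> D \<noteq> {}"
  obtains P where "prime_ideal R P" "P \<inter> D = {}"
    "\<And>J. ideal J R \<Longrightarrow> J \<inter> D = {} \<Longrightarrow> P \<subseteq> J \<Longrightarrow> J = P"
proof -
  define \<A> where "\<A> = {I. ideal I R \<and> I \<inter> D = {}}"
  have "\<exists>P\<in>\<A>. \<forall>J\<in>\<A>. P \<subseteq> J \<longrightarrow> J = P"
  proof (rule subset_Zorn_nonempty)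
    show "\<A> \<noteq> {}" using zeroideal assms(1) unfolding \<A>_def by auto
    fix \<C> assume "\<C> \<noteq> {}" "subset.chain \<A> \<C>"
    moreover from this have "subset.chain {I. ideal I R} \<C>"
      unfolding subset_chain_def \<A>_def by auto
    ultimately show "\<Union>\<C> \<in> \<A>"
      using chain_Union_is_ideal[of \<C>] unfolding \<A>_def subset_chain_def by auto
  qed
  then obtain P where "P \<in> \<A>" and "\<forall>J\<in>\<A>. P \<subseteq> J \<longrightarrow> J = P" by (rule bexE)
  then have P: "ideal P R" "P \<inter> D = {}"
    and max: "\<And>J. ideal J R \<Longrightarrow> J \<inter> D = {} \<Longrightarrow> P \<subseteq> J \<Longrightarrow> J = P"
    unfolding \<A>_def by auto
  interpret P: ideal P R by (rule P)
  have meets: "(I <+>\<^bsub>R\<^esub> P) \<inter> D \<noteq> {}" if I: "ideal I R" "\<not> I \<subseteq> P" for I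
  proof
    assume "(I <+>\<^bsub>R\<^esub> P) \<inter> D = {}"
    moreover have "P \<subseteq> I <+>\<^bsub>R\<^esub> P" "I \<subseteq> I <+>\<^bsub>R\<^esub> P"
    proof -
      interpret I: ideal I R by (rule I)
      show "P \<subseteq> I <+>\<^bsub>R\<^esub> P"
      proof
        fix p assume "p \<in> P"
        then show "p \<in> I <+>\<^bsub>R\<^esub> P"
          using I.zero_closed P.Icarr l_zero unfolding mem_set_add_iff by metis
      qed
      show "I \<subseteq> I <+>\<^bsub>R\<^esub> P"
      proof
        fix i assume "i \<in> I"
        then show "i \<in> I <+>\<^bsub>R\<^esub> P"
          using P.zero_closed I.Icarr r_zero unfolding mem_set_add_iff by metis
      qed
    qed
    ultimately show False using max[OF add_ideals[OF I(1) P(1)]] I(2) by blast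
  qed
  have "I \<subseteq> P \<or> J \<subseteq> P" if I: "ideal I R" and J: "ideal J R" and IJ: "ideal_prod R I J \<subseteq> P" for I J
  proof (rule ccontr)
    interpret I: ideal I R by (rule I)
    interpret J: ideal J R by (rule J)
    assume "\<not> (I \<subseteq> P \<or> J \<subseteq> P)"
    then have "ideal_prod R (I <+>\<^bsub>R\<^esub> P) (J <+>\<^bsub>R\<^esub> P) \<inter> D \<noteq> {}"
      using prod add_ideals I J P(1) meets by simp
    moreover have "ideal_prod R (I <+>\<^bsub>R\<^esub> P) (J <+>\<^bsub>R\<^esub> P) \<subseteq> P"
    proof
      fix z assume "z \<in> ideal_prod R (I <+>\<^bsub>R\<^esub> P) (J <+>\<^bsub>R\<^esub> P)"
      then show "z \<in> P"
      proof induction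
        case (prod x y)
        then obtain i p j q where xy: "i \<in> I" "p \<in> P" "j \<in> J" "q \<in> P" "x = i \<oplus> p" "y = j \<oplus> q"
          unfolding mem_set_add_iff by blast
        then have car: "i \<in> carrier R" "p \<in> carrier R" "j \<in> carrier R" "q \<in> carrier R"
          using I.Icarr J.Icarr P.Icarr by auto
        have "i \<otimes> j \<in> P" using IJ ideal_prod.prod[OF xy(1,3)] by blast
        moreover have "p \<otimes> j \<in> P" "i \<otimes> q \<in> P" "p \<otimes> q \<in> P"
          using xy car by (auto simp: P.I_l_closed P.I_r_closed)
        ultimately show ?case
          unfolding xy(5,6) using car by (simp add: l_distr r_distr P.a_closed)
      qed (rule P.a_closed)
    qed
    ultimately show False using P(2) by blast
  qed
  moreover have "P \<noteq> carrier R" using P(2) assms(2) by blast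
  ultimately have "prime_ideal R P" using P(1) unfolding prime_ideal_def by blast
  then show thesis using that P(2) max by blast
qed

section \<open>Prime ideals of a ring and of a subring\<close>

lemma (in ring) ideal_subring_Int:
  assumes "subring A R" "ideal K R"
  shows "ideal (K \<inter> A) (R\<lparr>carrier := A\<rparr>)"
proof -
  interpret A: ring "R\<lparr>carrier := A\<rparr>" by (rule subring_is_ring[OF assms(1)])
  interpret K: ideal K R by (rule assms(2))
  note A = subringE[OF assms(1)]
  show ?thesis
    by (rule A.idealI_closed)
      (use A K.I_l_closed K.I_r_closed in \<open>auto simp: K.a_closed K.zero_closed\<close>)
qed

text \<open>
  Disjointness from the complement of \<open>P\<close> in \<open>A\<close> means contracting into \<open>P\<close>. This complement
  is closed in the required sense because for \<open>x\<close> and \<open>y\<close> outside \<open>P\<close> some \<open>x r y\<close> is outside \<open>P\<close>.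
\<close>

lemma (in ring) exists_prime_ideal_contracting_into:
  assumes A: "subring A R" and P: "prime_ideal (R\<lparr>carrier := A\<rparr>) P"
  obtains Q where "prime_ideal R Q" "Q \<inter> A \<subseteq> P"
    "\<And>J. ideal J R \<Longrightarrow> J \<inter> A \<subseteq> P \<Longrightarrow> Q \<subseteq> J \<Longrightarrow> J = Q"
proof -
  interpret A: ring "R\<lparr>carrier := A\<rparr>" by (rule subring_is_ring[OF A])
  interpret P: ideal P "R\<lparr>carrier := A\<rparr>" using P by (simp add: prime_ideal_def)
  note Asub = subringE[OF A]
  have avoid: "J \<inter> A \<subseteq> P \<longleftrightarrow> J \<inter> (A - P) = {}" for J by blast
  have "ideal_prod R I J \<inter> (A - P) \<noteq> {}"
    if I: "ideal I R" "I \<inter> (A - P) \<noteq> {}" and J: "ideal J R" "J \<inter> (A - P) \<noteq> {}" for I J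
  proof -
    obtain x y where x: "x \<in> I" "x \<in> A" "x \<notin> P" and y: "y \<in> J" "y \<in> A" "y \<notin> P"
      using I J by blast
    then obtain r where r: "r \<in> A" "x \<otimes> r \<otimes> y \<notin> P"
      using P unfolding A.prime_ideal_iff by auto
    have "x \<otimes> r \<in> I" using ideal.I_r_closed[OF I(1)] x r Asub(1) by blast
    then have "x \<otimes> r \<otimes> y \<in> ideal_prod R I J" using y ideal_prod.prod by fast
    moreover have "x \<otimes> r \<otimes> y \<in> A" using x y r Asub(6) by simp
    ultimately show ?thesis using r by blast
  qed
  note prod = this
  have zero: "\<zero> \<notin> A - P" using P.zero_closed by simp
  have nonempty: "(A - P) \<inter> carrier R \<noteq> {}"
    using P Asub(1) P.a_subset unfolding prime_ideal_def by auto
  show thesis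
  proof (rule exists_prime_ideal_avoiding[OF zero nonempty prod])
    fix Q assume "prime_ideal R Q" "Q \<inter> (A - P) = {}"
      "\<And>J. ideal J R \<Longrightarrow> J \<inter> (A - P) = {} \<Longrightarrow> Q \<subseteq> J \<Longrightarrow> J = Q"
    then show thesis using that[of Q] unfolding avoid by simp
  qed
qed

text \<open>
  For an arbitrary subring the contraction of a prime ideal need not be prime. Here it is, because
  \<open>a A b \<subseteq> K\<close> already forces \<open>a (A + K) b \<subseteq> K\<close>.
\<close>

lemma (in ring) prime_ideal_contraction:
  assumes A: "subring A R" and K: "prime_ideal R K" and sum: "A <+>\<^bsub>R\<^esub> K = carrier R"
  shows "prime_ideal (R\<lparr>carrier := A\<rparr>) (K \<inter> A)"
proof -
  interpret A: ring "R\<lparr>carrier := A\<rparr>" by (rule subring_is_ring[OF A])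
  interpret K: ideal K R using K by (simp add: prime_ideal_def)
  note Asub = subringE[OF A]
  have "a \<in> K \<or> b \<in> K" if a: "a \<in> A" and b: "b \<in> A" and aAb: "\<forall>r \<in> A. a \<otimes> r \<otimes> b \<in> K" for a b
  proof -
    have ab: "a \<in> carrier R" "b \<in> carrier R" using a b Asub(1) by auto
    have "a \<otimes> s \<otimes> b \<in> K" if s: "s \<in> carrier R" for s
    proof -
      obtain r k where "r \<in> A" "k \<in> K" "s = r \<oplus> k"
        using s unfolding sum[symmetric] mem_set_add_iff by blast
      moreover from this have "r \<in> carrier R" "k \<in> carrier R" using Asub(1) K.Icarr by auto
      ultimately show ?thesis
        using ab aAb by (simp add: l_distr r_distr K.a_closed K.I_l_closed K.I_r_closed)
    qed
    then show ?thesis using K ab unfolding prime_ideal_iff by blast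
  qed
  moreover have "K \<inter> A \<noteq> A"
    using K Asub(3) K.one_imp_carrier unfolding prime_ideal_def by blast
  ultimately show ?thesis
    unfolding A.prime_ideal_iff using ideal_subring_Int[OF A K.ideal_axioms] by auto
qed

lemma (in ideal) rcos_image_carrier: "(+>) I ` carrier R = carrier (R Quot I)"
  unfolding FactRing_simps by auto

text \<open>
  The second isomorphism theorem: the projection modulo \<open>K\<close> is surjective on \<open>A\<close>, with
  kernel \<open>K \<inter> A\<close>.
\<close>

lemma (in ring) quotient_contraction_iso:
  assumes A: "subring A R" and K: "ideal K R" and sum: "A <+>\<^bsub>R\<^esub> K = carrier R"
  shows "R\<lparr>carrier := A\<rparr> Quot (K \<inter> A) \<simeq> R Quot K"
proof -
  interpret K: ideal K R by (rule K)
  interpret h: ring_hom_ring "R\<lparr>carrier := A\<rparr>" "R Quot K" "(+>) K"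
    by (rule ring_hom_ring.induced_ring_hom[OF K.rcos_ring_hom_ring A])
  note Asub = subringE(1)[OF A]
  have coset: "K +> (r \<oplus> k) = K +> r" if "r \<in> A" "k \<in> K" for r k
  proof (rule K.a_repr_independence'[symmetric])
    show "r \<oplus> k \<in> K +> r"
      using that Asub K.Icarr by (auto simp: a_r_coset_def' intro!: bexI[of _ k] a_comm)
  qed (use that Asub in auto)
  have "(+>) K ` A = carrier (R Quot K)"
  proof
    show "carrier (R Quot K) \<subseteq> (+>) K ` A"
    proof
      fix X assume "X \<in> carrier (R Quot K)"
      then obtain s where s: "s \<in> carrier R" "X = K +> s"
        unfolding K.rcos_image_carrier[symmetric] by blast
      then obtain r k where "r \<in> A" "k \<in> K" "s = r \<oplus> k"
        unfolding sum[symmetric] mem_set_add_iff by blast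
      then show "X \<in> (+>) K ` A" using s coset by auto
    qed
  qed (use h.hom_closed in auto)
  moreover have "a_kernel (R\<lparr>carrier := A\<rparr>) (R Quot K) ((+>) K) = K \<inter> A"
  proof -
    have "K +> a = K \<longleftrightarrow> a \<in> K" if "a \<in> A" for a
      using that Asub K.rcos_const_imp_mem K.a_rcos_const by blast
    then show ?thesis unfolding a_kernel_def' by (auto simp: FactRing_def)
  qed
  ultimately show ?thesis using h.FactRing_iso by simp
qed

text \<open>
  The prime ideal \<open>Q\<close> maximal with \<open>Q \<inter> A \<subseteq> P\<close> does the job. Since \<open>R = A + Q\<close>, the set \<open>P + Q\<close> absorbs
  multiplication by all of \<open>R\<close>, not only by \<open>A\<close>, so it is an ideal that competes with \<open>Q\<close>.
\<close>

lemma (in ring) lying_over: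
  assumes A: "subring A R" and P: "prime_ideal (R\<lparr>carrier := A\<rparr>) P"
    and sum: "\<And>K. prime_ideal R K \<Longrightarrow> A <+>\<^bsub>R\<^esub> K = carrier R"
  obtains Q where "prime_ideal R Q" "Q \<inter> A = P"
proof -
  interpret P: ideal P "R\<lparr>carrier := A\<rparr>" using P by (simp add: prime_ideal_def)
  note Asub = subringE[OF A]
  obtain Q where Q: "prime_ideal R Q" "Q \<inter> A \<subseteq> P"
    and max: "\<And>J. ideal J R \<Longrightarrow> J \<inter> A \<subseteq> P \<Longrightarrow> Q \<subseteq> J \<Longrightarrow> J = Q"
    using exists_prime_ideal_contracting_into[OF A P] by blast
  interpret Q: ideal Q R using Q by (simp add: prime_ideal_def)
  have P_A: "P \<subseteq> A" using P.a_subset by simp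
  have P_zero: "\<zero> \<in> P"
    using additive_subgroup.zero_closed[OF P.additive_subgroup_axioms] by simp
  define J where "J = P <+>\<^bsub>R\<^esub> Q"
  have J: "x \<in> J \<longleftrightarrow> (\<exists>p \<in> P. \<exists>q \<in> Q. x = p \<oplus> q)" for x
    unfolding J_def by (rule mem_set_add_iff)
  have J_intro: "p \<oplus> q \<in> J" if "p \<in> P" "q \<in> Q" for p q
    unfolding J using that by blast
  have car: "x \<in> carrier R" if "x \<in> P \<or> x \<in> Q \<or> x \<in> A" for x
    using that P_A Asub(1) Q.Icarr by auto
  have QJ: "Q \<subseteq> J"
  proof
    fix q assume "q \<in> Q"
    then show "q \<in> J" using J_intro[OF P_zero, of q] car by simp
  qed
  have "ideal J R"
  proof (rule idealI_closed)
    show "J \<subseteq> carrier R" 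
    proof
      fix x assume "x \<in> J"
      then obtain p q where "p \<in> P" "q \<in> Q" "x = p \<oplus> q" unfolding J by blast
      then show "x \<in> carrier R" using car by simp
    qed
    show "\<zero> \<in> J" using QJ Q.zero_closed by blast
  next
    fix x y assume "x \<in> J" "y \<in> J"
    then obtain p q p' q' where *: "p \<in> P" "q \<in> Q" "x = p \<oplus> q" "p' \<in> P" "q' \<in> Q" "y = p' \<oplus> q'"
      unfolding J by blast
    then have "x \<oplus> y = (p \<oplus> p') \<oplus> (q \<oplus> q')" using car by (simp add: a_ac)
    moreover have "p \<oplus> p' \<in> P"
      using additive_subgroup.a_closed[OF P.additive_subgroup_axioms] * by simp
    ultimately show "x \<oplus> y \<in> J" using J_intro Q.a_closed * by simp
  next
    fix x s assume "x \<in> J" "s \<in> carrier R"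
    then obtain p q r k where *: "p \<in> P" "q \<in> Q" "x = p \<oplus> q" "r \<in> A" "k \<in> Q" "s = r \<oplus> k"
      unfolding sum[OF Q(1), symmetric] J mem_set_add_iff by blast
    have c: "p \<in> carrier R" "q \<in> carrier R" "r \<in> carrier R" "k \<in> carrier R"
      using * car by auto
    have "s \<otimes> x = r \<otimes> p \<oplus> (r \<otimes> q \<oplus> k \<otimes> p \<oplus> k \<otimes> q)"
      "x \<otimes> s = p \<otimes> r \<oplus> (q \<otimes> r \<oplus> p \<otimes> k \<oplus> q \<otimes> k)"
      unfolding * using c by (simp_all add: l_distr r_distr a_ac)
    moreover have "r \<otimes> p \<in> P" "p \<otimes> r \<in> P"
      using P.I_l_closed[OF *(1), of r] P.I_r_closed[OF *(1), of r] *(4) by simp_all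
    moreover have "r \<otimes> q \<oplus> k \<otimes> p \<oplus> k \<otimes> q \<in> Q" "q \<otimes> r \<oplus> p \<otimes> k \<oplus> q \<otimes> k \<in> Q"
      by (intro Q.a_closed Q.I_l_closed Q.I_r_closed *(2,5) c)+
    ultimately show "s \<otimes> x \<in> J" "x \<otimes> s \<in> J" using J_intro by simp_all
  qed
  \<comment> \<open>The modular law: as \<open>P \<subseteq> A\<close>, also \<open>(P + Q) \<inter> A = P + (Q \<inter> A) \<subseteq> P\<close>.\<close>
  moreover have "J \<inter> A \<subseteq> P"
  proof
    fix x assume x: "x \<in> J \<inter> A"
    then have "x \<in> J" by simp
    then obtain p q where *: "p \<in> P" "q \<in> Q" "x = p \<oplus> q" unfolding J by blast
    have "\<ominus> p \<oplus> x \<in> A" using *(1) x P_A Asub(5,7) by blast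
    moreover have "\<ominus> p \<oplus> x = q" unfolding *(3) using * car by (simp add: l_neg a_assoc[symmetric])
    ultimately have "q \<in> A" by simp
    then show "x \<in> P" using * Q(2) additive_subgroup.a_closed[OF P.additive_subgroup_axioms, of p q] by auto
  qed
  ultimately have "J = Q" using max QJ by blast
  moreover have "P \<subseteq> J"
  proof
    fix p assume "p \<in> P"
    then show "p \<in> J" using J_intro[OF _ Q.zero_closed, of p] car by simp
  qed
  ultimately show thesis using that Q P_A by blast
qed

section \<open>Transfer of properties determined by prime factors\<close>

lemma has_property_cong_iso:
  assumes "ring B" "B \<simeq> B'"
  shows "has_property (\<C> :: 'c ring \<Rightarrow> bool) B \<longleftrightarrow> has_property \<C> B'"
proof -
  have "A \<simeq> B \<longleftrightarrow> A \<simeq> B'" for A :: "'c ring"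
    using ring_iso_trans[OF _ assms(2)] ring_iso_trans[OF _ ring_iso_sym[OF assms]] by blast
  then show ?thesis unfolding has_property_def by simp
qed

text \<open>
  Under \<open>A + K = S\<close>, the rule \<open>K \<mapsto> K \<inter> A\<close> maps the prime ideals of \<open>S\<close> onto those of \<open>A\<close> and preserves the
  factor rings; surjectivity is \<open>lying_over\<close>.
\<close>

theorem property_iff_of_sum_with_primes:
  fixes S :: "'a ring"
  assumes "ring S" and A: "subring A S"
    and sum: "\<And>K. prime_ideal S K \<Longrightarrow> A <+>\<^bsub>S\<^esub> K = carrier S"
    and \<C>: "determined_by_prime_factors \<C>"
  shows "\<C> (S\<lparr>carrier := A\<rparr>) \<longleftrightarrow> \<C> S"
proof -
  interpret ring S by fact
  have A_ring: "ring (S\<lparr>carrier := A\<rparr>)" by (rule subring_is_ring[OF A])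
  have factors: "has_property \<C> (S\<lparr>carrier := A\<rparr> Quot (K \<inter> A)) \<longleftrightarrow> has_property \<C> (S Quot K)"
    if K: "prime_ideal S K" for K
  proof (rule has_property_cong_iso)
    have K_ideal: "ideal K S" using K by (simp add: prime_ideal_def)
    show "ring (S\<lparr>carrier := A\<rparr> Quot (K \<inter> A))"
      by (rule ideal.quotient_is_ring[OF ideal_subring_Int[OF A K_ideal]])
    show "S\<lparr>carrier := A\<rparr> Quot (K \<inter> A) \<simeq> S Quot K"
      by (rule quotient_contraction_iso[OF A K_ideal sum[OF K]])
  qed
  show ?thesis
  proof
    assume "\<C> (S\<lparr>carrier := A\<rparr>)"
    then have "has_property \<C> (S Quot K)" if "prime_ideal S K" for K
      using that \<C> A_ring factors prime_ideal_contraction[OF A that sum[OF that]]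
      unfolding determined_by_prime_factors_def by blast
    then show "\<C> S" using \<C> ring_axioms unfolding determined_by_prime_factors_def by blast
  next
    assume "\<C> S"
    have "has_property \<C> (S\<lparr>carrier := A\<rparr> Quot P)" if P: "prime_ideal (S\<lparr>carrier := A\<rparr>) P" for P
    proof -
      obtain Q where Q: "prime_ideal S Q" "Q \<inter> A = P"
        using lying_over[OF A P sum] by blast
      moreover have "has_property \<C> (S Quot Q)"
        using \<open>\<C> S\<close> \<C> ring_axioms Q(1) unfolding determined_by_prime_factors_def by blast
      ultimately show ?thesis using factors by blast
    qed
    then show "\<C> (S\<lparr>carrier := A\<rparr>)"
      using \<C> A_ring unfolding determined_by_prime_factors_def by blast
  qed
qed

section \<open>Idempotents that are central modulo the prime radical\<close>

text \<open>
  The conclusion says that \<open>e\<close> is \<open>0\<close> or \<open>1\<close> modulo \<open>K\<close>: as \<open>e\<close> commutes with everything modulo \<open>K\<close>,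
  the product \<open>e s (1 - e)\<close> is \<open>s e (1 - e) = 0\<close> modulo \<open>K\<close>. Congruence modulo \<open>K\<close> is written with sums because
  the lemma is applied to a subring, where sums, unlike differences, are those of the overring by
  definition.
\<close>

lemma (in ring) idempotent_central_mod_prime:
  assumes K: "prime_ideal R K" and e: "e \<in> carrier R" "e \<otimes> e = e"
    and comm: "\<And>s. s \<in> carrier R \<Longrightarrow> \<exists>k \<in> K. e \<otimes> s = s \<otimes> e \<oplus> k"
  shows "\<exists>c \<in> {\<zero>, \<one>}. \<exists>k \<in> K. e = c \<oplus> k"
proof -
  interpret K: ideal K R using K by (simp add: prime_ideal_def)
  define f where "f = \<one> \<ominus> e"
  have f: "f \<in> carrier R" "e \<otimes> f = \<zero>" "e = \<one> \<oplus> \<ominus> f"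
    using e unfolding f_def a_minus_def by (auto simp: r_distr r_minus r_neg minus_add r_neg1 a_assoc[symmetric])
  have "e \<otimes> s \<otimes> f \<in> K" if s: "s \<in> carrier R" for s
  proof -
    obtain k where k: "k \<in> K" "e \<otimes> s = s \<otimes> e \<oplus> k" using comm[OF s] by blast
    then have "e \<otimes> s \<otimes> f = s \<otimes> (e \<otimes> f) \<oplus> k \<otimes> f"
      using s e f(1) K.Icarr by (simp add: l_distr m_assoc)
    then show ?thesis using k s f K.Icarr by (simp add: K.I_r_closed)
  qed
  then consider "e \<in> K" | "f \<in> K" using K e f(1) unfolding prime_ideal_iff by blast
  then show ?thesis
  proof cases
    case 1
    have "e = \<zero> \<oplus> e" using e by simp
    with 1 show ?thesis by blast
  next
    case 2
    then have "\<ominus> f \<in> K" by (rule K.a_inv_closed)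
    with f(3) show ?thesis by blast
  qed
qed

text \<open>
  A ring without prime ideals is treated apart: its prime radical is the whole ring, whereas
  \<open>i_Intersect\<close> is about nonempty families.
\<close>

lemma (in ring) prime_radical_ideal: "ideal (prime_radical R) R"
proof (cases "\<exists>P. prime_ideal R P")
  case True
  then obtain P where P: "prime_ideal R P" ..
  then have "P \<subseteq> carrier R"
    using ideal.Icarr[of P R] by (auto simp: prime_ideal_def)
  then have "prime_radical R = \<Inter> {P. prime_ideal R P}"
    using P unfolding prime_radical_def by blast
  moreover have "ideal (\<Inter> {P. prime_ideal R P}) R"
  proof (rule i_Intersect)
    show "ideal P R" if "P \<in> {P. prime_ideal R P}" for P
      using that by (simp add: prime_ideal_def)
  qed (use P in blast)
  ultimately show ?thesis by simp
next
  case False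
  then show ?thesis using oneideal by (simp add: prime_radical_def)
qed

text \<open>
  Modulo \<open>K\<close> the generators lie in the image of \<open>A\<close>, which contains \<open>0\<close> and \<open>1\<close>, and this image is closed under
  the ring operations. Commutators with elements of \<open>E\<close> lie in the prime radical of the big ring; they
  are in \<open>K\<close> because some prime ideal of the big ring contracts into \<open>K\<close>.
\<close>

lemma (in ring) subring_eq_sum_with_prime:
  assumes A: "subring A R" and E: "E \<subseteq> idempotents_central_mod_prime_radical R"
    and K: "prime_ideal (R\<lparr>carrier := generate_ring R (A \<union> E)\<rparr>) K"
  shows "A <+>\<^bsub>R\<^esub> K = generate_ring R (A \<union> E)"
proof -
  define S where "S = generate_ring R (A \<union> E)"
  have E_car: "E \<subseteq> carrier R"
    using E unfolding idempotents_central_mod_prime_radical_def by blast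
  note Asub = subringE[OF A]
  have AE: "A \<union> E \<subseteq> carrier R" using Asub(1) E_car by blast
  have S: "subring S R" unfolding S_def by (rule generate_ring_is_subring[OF AE])
  note Ssub = subringE[OF S]
  interpret S: ring "R\<lparr>carrier := S\<rparr>" by (rule subring_is_ring[OF S])
  have K: "prime_ideal (R\<lparr>carrier := S\<rparr>) K" using K by (simp add: S_def)
  interpret K: ideal K "R\<lparr>carrier := S\<rparr>" using K by (simp add: prime_ideal_def)
  interpret N: ideal "prime_radical R" R by (rule prime_radical_ideal)
  have KS: "K \<subseteq> S" using K.a_subset by simp
  have AS: "A \<union> E \<subseteq> S" unfolding S_def by (rule subsetI) (rule generate_ring.incl)
  have car: "x \<in> carrier R" if "x \<in> A \<or> x \<in> K \<or> x \<in> S" for x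
    using that Asub(1) KS Ssub(1) by blast
  have N_K: "prime_radical R \<inter> S \<subseteq> K"
  proof -
    obtain Q where Q: "prime_ideal R Q" "Q \<inter> S \<subseteq> K"
      using exists_prime_ideal_contracting_into[OF S K] .
    then have "prime_radical R \<subseteq> Q" unfolding prime_radical_def by blast
    then show ?thesis using Q(2) by blast
  qed
  have K_zero: "\<zero> \<in> K"
    using additive_subgroup.zero_closed[OF K.additive_subgroup_axioms] by simp
  have E_sum: "\<exists>c \<in> {\<zero>, \<one>}. \<exists>k \<in> K. e = c \<oplus> k" if "e \<in> E" for e
  proof -
    have e: "e \<in> carrier R" "e \<otimes> e = e" "e \<in> S"
      and central: "central (R Quot prime_radical R) (prime_radical R +> e)"
      using that E AS unfolding idempotents_central_mod_prime_radical_def by auto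
    have "\<exists>k \<in> K. e \<otimes> s = s \<otimes> e \<oplus> k" if s: "s \<in> S" for s
    proof
      have sc: "s \<in> carrier R" using s Ssub(1) by blast
      have "prime_radical R +> s \<in> carrier (R Quot prime_radical R)"
        using ring_hom_closed[OF N.rcos_ring_hom sc] .
      then have "prime_radical R +> (e \<otimes> s) = prime_radical R +> (s \<otimes> e)"
        using central ring_hom_mult[OF N.rcos_ring_hom e(1) sc] ring_hom_mult[OF N.rcos_ring_hom sc e(1)]
        unfolding central_def by simp
      then have "e \<otimes> s \<ominus> s \<otimes> e \<in> prime_radical R"
        using quotient_eq_iff_same_a_r_cos[OF N.ideal_axioms] e sc by simp
      moreover have "e \<otimes> s \<ominus> s \<otimes> e \<in> S"
        using e s Ssub(5-7) unfolding a_minus_def by simp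
      ultimately show "e \<otimes> s \<ominus> s \<otimes> e \<in> K" using N_K by blast
      show "e \<otimes> s = s \<otimes> e \<oplus> (e \<otimes> s \<ominus> s \<otimes> e)"
        using e(1) sc unfolding a_minus_def by (simp add: r_neg1 r_neg2 r_neg a_ac)
    qed
    then show ?thesis using S.idempotent_central_mod_prime[OF K, of e] e by simp
  qed
  have K_add: "x \<oplus> y \<in> K" if "x \<in> K" "y \<in> K" for x y
    using additive_subgroup.a_closed[OF K.additive_subgroup_axioms] that by simp
  have K_mult: "x \<otimes> y \<in> K" "y \<otimes> x \<in> K" if "x \<in> S" "y \<in> K" for x y
    using K.I_l_closed K.I_r_closed that by auto
  have K_neg: "\<ominus> x \<in> K" if "x \<in> K" for x
  proof -
    have "\<ominus> \<one> \<otimes> x \<in> K" using that Ssub(3,5) K_mult by blast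
    then show ?thesis using that car by (simp add: l_minus)
  qed
  have A_S: "x \<in> S" if "x \<in> A" for x using that AS by blast
  have "S \<subseteq> A <+>\<^bsub>R\<^esub> K"
  proof
    fix s assume "s \<in> S"
    then show "s \<in> A <+>\<^bsub>R\<^esub> K" unfolding S_def
    proof induction
      case one
      have "\<one> = \<one> \<oplus> \<zero>" by simp
      then show ?case using Asub(3) K_zero unfolding mem_set_add_iff by blast
    next
      case (incl h)
      show ?case
      proof (cases "h \<in> A")
        case True
        then have "h = h \<oplus> \<zero>" using car by simp
        then show ?thesis using True K_zero unfolding mem_set_add_iff by blast
      next
        case False
        then show ?thesis using incl E_sum Asub(2,3) unfolding mem_set_add_iff by blast
      qed
    next
      case (a_inv h)
      then obtain a k where "a \<in> A" "k \<in> K" "h = a \<oplus> k" unfolding mem_set_add_iff by blast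
      moreover from this have "\<ominus> h = \<ominus> a \<oplus> \<ominus> k" using car minus_add by simp
      ultimately show ?case using Asub(5) K_neg unfolding mem_set_add_iff by blast
    next
      case (eng_add g h)
      then obtain a k b l where *: "a \<in> A" "k \<in> K" "g = a \<oplus> k" "b \<in> A" "l \<in> K" "h = b \<oplus> l"
        unfolding mem_set_add_iff by blast
      then have "g \<oplus> h = (a \<oplus> b) \<oplus> (k \<oplus> l)" using car by (simp add: a_ac)
      then show ?case using * Asub(7) K_add unfolding mem_set_add_iff by blast
    next
      case (eng_mult g h)
      then obtain a k b l where *: "a \<in> A" "k \<in> K" "g = a \<oplus> k" "b \<in> A" "l \<in> K" "h = b \<oplus> l"
        unfolding mem_set_add_iff by blast
      then have "g \<otimes> h = a \<otimes> b \<oplus> (k \<otimes> b \<oplus> a \<otimes> l \<oplus> k \<otimes> l)"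
        using car by (simp add: l_distr r_distr a_ac)
      moreover have "k \<otimes> b \<oplus> a \<otimes> l \<oplus> k \<otimes> l \<in> K"
        using * K_add K_mult A_S KS by (meson subsetD)
      ultimately show ?case using * Asub(6) unfolding mem_set_add_iff by blast
    qed
  qed
  moreover have "A <+>\<^bsub>R\<^esub> K \<subseteq> S"
  proof
    fix s assume "s \<in> A <+>\<^bsub>R\<^esub> K"
    then show "s \<in> S" unfolding mem_set_add_iff using A_S KS Ssub(7) by blast
  qed
  ultimately show ?thesis by (simp add: S_def)
qed

section \<open>Strong \<open>\<pi>\<close>-regularity is determined by prime factors\<close>

lemma (in ring) strongly_pi_regular_iff:
  "strongly_pi_regular R \<longleftrightarrow>
     (\<forall>x \<in> carrier R. \<exists>n::nat. n > 0 \<and> (\<exists>r \<in> carrier R. x [^] n = x [^] (n + 1) \<otimes> r))"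
  unfolding strongly_pi_regular_def l_coset_def by blast

lemma (in ring_hom_ring) strongly_pi_regular_image:
  assumes spr: "strongly_pi_regular R" and surj: "h ` carrier R = carrier S"
  shows "strongly_pi_regular S"
  unfolding S.strongly_pi_regular_iff
proof
  fix y assume "y \<in> carrier S"
  then obtain x where x: "x \<in> carrier R" "y = h x" using surj by blast
  then obtain n :: nat and r where *: "n > 0" "r \<in> carrier R" "x [^] n = x [^] (n + 1) \<otimes> r"
    using spr unfolding R.strongly_pi_regular_iff by blast
  have "h (x [^] n) = h (x [^] (n + 1)) \<otimes>\<^bsub>S\<^esub> h r"
    unfolding *(3) by (rule hom_mult) (use x * in auto)
  then have "y [^]\<^bsub>S\<^esub> n = y [^]\<^bsub>S\<^esub> (n + 1) \<otimes>\<^bsub>S\<^esub> h r"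
    unfolding x(2) hom_nat_pow[OF x(1)] .
  moreover have "h r \<in> carrier S" using * by simp
  ultimately show "\<exists>n::nat. n > 0 \<and> (\<exists>r \<in> carrier S. y [^]\<^bsub>S\<^esub> n = y [^]\<^bsub>S\<^esub> (n + 1) \<otimes>\<^bsub>S\<^esub> r)"
    using \<open>n > 0\<close> by blast
qed

lemma strongly_pi_regular_iso_imp:
  assumes "ring A" "ring B" "A \<simeq> B" "strongly_pi_regular A"
  shows "strongly_pi_regular B"
proof -
  obtain h where h: "h \<in> ring_iso A B" using \<open>A \<simeq> B\<close> unfolding is_ring_iso_def by blast
  interpret h: ring_hom_ring A B h
    using assms(1,2) h by (intro ring_hom_ringI2) (auto simp: ring_iso_def)
  show ?thesis
    using h.strongly_pi_regular_image assms(4) h by (auto simp: ring_iso_def bij_betw_def)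
qed

lemma strongly_pi_regular_iso:
  assumes "ring A" "ring B" "A \<simeq> B"
  shows "strongly_pi_regular A \<longleftrightarrow> strongly_pi_regular B"
  using strongly_pi_regular_iso_imp[OF assms]
    strongly_pi_regular_iso_imp[OF assms(2,1) ring_iso_sym[OF assms(1,3)]] by (rule iffI)

lemma (in ring) strongly_pi_regular_quotient:
  assumes I: "ideal I R" and "strongly_pi_regular R"
  shows "strongly_pi_regular (R Quot I)"
proof -
  interpret ring_hom_ring R "R Quot I" "(+>) I" by (rule ideal.rcos_ring_hom_ring[OF I])
  show ?thesis
    by (rule strongly_pi_regular_image[OF assms(2) ideal.rcos_image_carrier[OF I]])
qed

text \<open>
  Iterating \<open>x\<^sup>n = x\<^sup>n\<^sup>+\<^sup>1r\<close> modulo \<open>I\<close> raises the power of \<open>x\<close> on the right-hand side as far as desired: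
  \<open>x\<^sup>n\<^sup>+\<^sup>kr\<^sup>k = x\<^sup>k(x\<^sup>n)r\<^sup>k = x\<^sup>k(x\<^sup>n\<^sup>+\<^sup>1r)r\<^sup>k\<close>.
\<close>

lemma (in ring) ideal_power_iterate:
  fixes n k :: nat
  assumes I: "ideal I R" and x: "x \<in> carrier R" "r \<in> carrier R"
    and mem: "x [^] n \<ominus> x [^] (n + 1) \<otimes> r \<in> I"
  shows "x [^] n \<ominus> x [^] (n + k) \<otimes> r [^] k \<in> I"
proof (induction k)
  case 0
  then show ?case using x ideal.axioms(1)[OF I, THEN additive_subgroup.zero_closed]
    by (simp add: a_minus_def r_neg)
next
  case (Suc k)
  have "x [^] k \<otimes> (x [^] n \<ominus> x [^] (n + 1) \<otimes> r) \<otimes> r [^] k \<in> I"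
    by (intro ideal.I_r_closed[OF I] ideal.I_l_closed[OF I] mem nat_pow_closed x)
  moreover have "x [^] k \<otimes> (x [^] n \<ominus> x [^] (n + 1) \<otimes> r) \<otimes> r [^] k
      = x [^] (n + k) \<otimes> r [^] k \<ominus> x [^] (n + Suc k) \<otimes> r [^] Suc k"
  proof -
    have "x [^] k \<otimes> (x [^] (n + 1) \<otimes> r) \<otimes> r [^] k
        = (x [^] k \<otimes> x [^] (n + 1)) \<otimes> (r [^] (1::nat) \<otimes> r [^] k)"
      using x by (simp add: m_assoc del: nat_pow_Suc)
    also have "\<dots> = x [^] (n + Suc k) \<otimes> r [^] Suc k"
      using x by (simp only: nat_pow_mult) (simp add: add.commute del: nat_pow_Suc)
    finally have right: "x [^] k \<otimes> (x [^] (n + 1) \<otimes> r) \<otimes> r [^] k = x [^] (n + Suc k) \<otimes> r [^] Suc k" .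
    have left: "x [^] k \<otimes> x [^] n = x [^] (n + k)"
      using x by (simp add: nat_pow_mult add.commute)
    show ?thesis
      unfolding right[symmetric] left[symmetric] a_minus_def using x
      by (simp add: l_distr r_distr l_minus r_minus del: nat_pow_Suc)
  qed
  ultimately have "(x [^] n \<ominus> x [^] (n + k) \<otimes> r [^] k)
      \<oplus> (x [^] (n + k) \<otimes> r [^] k \<ominus> x [^] (n + Suc k) \<otimes> r [^] Suc k) \<in> I"
    using Suc additive_subgroup.a_closed[OF ideal.axioms(1)[OF I]] by metis
  moreover have "(a \<ominus> b) \<oplus> (b \<ominus> c) = a \<ominus> c"
    if "a \<in> carrier R" "b \<in> carrier R" "c \<in> carrier R" for a b c
    using that by (simp add: a_minus_def a_assoc r_neg1)
  ultimately show ?case using x by (simp del: nat_pow_Suc)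
qed

text \<open>
  For a bad element \<open>x\<close>, let \<open>D\<close> consist of all \<open>x\<^sup>n - x\<^sup>n\<^sup>+\<^sup>1r\<close>; an ideal avoids \<open>D\<close> iff \<open>x\<close> stays
  bad modulo it. A product of ideals meeting \<open>D\<close> meets \<open>D\<close>: multiplying \<open>x\<^sup>n - x\<^sup>n\<^sup>+\<^sup>1r\<close> and \<open>x\<^sup>m - x\<^sup>m\<^sup>+\<^sup>1s\<close>
  directly leaves a term \<open>x\<^sup>n\<^sup>+\<^sup>1r x\<^sup>m\<close>, in which \<open>r\<close> blocks the powers of \<open>x\<close> from merging. The first factor
  is therefore replaced by \<open>x\<^sup>n - x\<^sup>n\<^sup>+\<^sup>m\<^sup>+\<^sup>1t\<close>, so that this term already starts with \<open>x\<^sup>n\<^sup>+\<^sup>m\<^sup>+\<^sup>1\<close>.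
\<close>

lemma (in ring) strongly_pi_regular_if_prime_quotients:
  assumes spr: "\<And>P. prime_ideal R P \<Longrightarrow> strongly_pi_regular (R Quot P)"
  shows "strongly_pi_regular R"
proof (rule ccontr)
  assume "\<not> strongly_pi_regular R"
  then obtain x where x: "x \<in> carrier R"
    and fail: "\<And>n::nat. \<And>r. n > 0 \<Longrightarrow> r \<in> carrier R \<Longrightarrow> x [^] n \<noteq> x [^] (n + 1) \<otimes> r"
    unfolding strongly_pi_regular_iff by blast
  define D where "D = {x [^] n \<ominus> x [^] (n + 1) \<otimes> r |n r. n > (0::nat) \<and> r \<in> carrier R}"
  have "\<zero> \<notin> D"
  proof
    assume "\<zero> \<in> D"
    then obtain n :: nat and r where *: "n > 0" "r \<in> carrier R" "\<zero> = x [^] n \<ominus> x [^] (n + 1) \<otimes> r"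
      unfolding D_def by blast
    then have "x [^] n = x [^] (n + 1) \<otimes> r"
      using x r_right_minus_eq[of "x [^] n" "x [^] (n + 1) \<otimes> r"] by simp
    then show False using fail * by blast
  qed
  moreover have "D \<inter> carrier R \<noteq> {}"
  proof -
    have "x [^] (1::nat) \<ominus> x [^] (1 + 1::nat) \<otimes> \<one> \<in> D" unfolding D_def by blast
    moreover have "x [^] (1::nat) \<ominus> x [^] (1 + 1::nat) \<otimes> \<one> \<in> carrier R" using x by simp
    ultimately show ?thesis by blast
  qed
  moreover have "ideal_prod R I J \<inter> D \<noteq> {}"
    if I: "ideal I R" "I \<inter> D \<noteq> {}" and J: "ideal J R" "J \<inter> D \<noteq> {}" for I J
  proof -
    obtain n :: nat and r where n: "n > 0" "r \<in> carrier R" "x [^] n \<ominus> x [^] (n + 1) \<otimes> r \<in> I"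
      using I unfolding D_def by blast
    obtain m :: nat and s where m: "m > 0" "s \<in> carrier R" "x [^] m \<ominus> x [^] (m + 1) \<otimes> s \<in> J"
      using J unfolding D_def by blast
    define t where "t = r [^] (m + 1)"
    define v where "v = x [^] m \<ominus> x [^] (m + 1) \<otimes> s"
    have t: "t \<in> carrier R" and v: "v \<in> carrier R" using n m x by (auto simp: t_def v_def)
    have "x [^] n \<ominus> x [^] (n + (m + 1)) \<otimes> t \<in> I"
      unfolding t_def by (rule ideal_power_iterate[OF I(1) x n(2,3)])
    then have "(x [^] n \<ominus> x [^] (n + (m + 1)) \<otimes> t) \<otimes> v \<in> ideal_prod R I J"
      using m(3) ideal_prod.prod unfolding v_def by fast
    moreover have "(x [^] n \<ominus> x [^] (n + (m + 1)) \<otimes> t) \<otimes> v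
        = x [^] (n + m) \<ominus> x [^] (n + m + 1) \<otimes> (s \<oplus> t \<otimes> v)"
    proof -
      have "x [^] n \<otimes> v = x [^] (n + m) \<ominus> x [^] (n + m + 1) \<otimes> s"
      proof -
        have "x [^] n \<otimes> v = x [^] n \<otimes> x [^] m \<ominus> x [^] n \<otimes> x [^] (m + 1) \<otimes> s"
          unfolding v_def a_minus_def using x m
          by (simp add: r_distr r_minus m_assoc del: nat_pow_Suc)
        then show ?thesis using x by (simp only: nat_pow_mult add.assoc)
      qed
      then show ?thesis using x t v m
        unfolding a_minus_def
        by (simp add: l_distr r_distr l_minus minus_add m_assoc a_assoc add.assoc del: nat_pow_Suc)
    qed
    moreover have "x [^] (n + m) \<ominus> x [^] (n + m + 1) \<otimes> (s \<oplus> t \<otimes> v) \<in> D"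
      unfolding D_def using n m t v by blast
    ultimately show ?thesis by auto
  qed
  ultimately obtain P where P: "prime_ideal R P" "P \<inter> D = {}"
    by (rule exists_prime_ideal_avoiding) auto
  interpret P: ideal P R using P by (simp add: prime_ideal_def)
  interpret h: ring_hom_ring R "R Quot P" "(+>) P" by (rule P.rcos_ring_hom_ring)
  obtain n :: nat and Y where n: "n > 0" "Y \<in> carrier (R Quot P)"
    "(P +> x) [^]\<^bsub>R Quot P\<^esub> n = (P +> x) [^]\<^bsub>R Quot P\<^esub> (n + 1) \<otimes>\<^bsub>R Quot P\<^esub> Y"
    using spr[OF P(1)] h.hom_closed[OF x] unfolding h.S.strongly_pi_regular_iff by blast
  obtain r where r: "r \<in> carrier R" "Y = P +> r"
    using n(2) unfolding P.rcos_image_carrier[symmetric] by blast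
  have "P +> (x [^] n) = P +> (x [^] (n + 1) \<otimes> r)"
    using n(3) r x h.hom_nat_pow[OF x, symmetric] h.hom_mult by (simp del: nat_pow_Suc)
  then have "x [^] n \<ominus> x [^] (n + 1) \<otimes> r \<in> P"
    using quotient_eq_iff_same_a_r_cos[OF P.ideal_axioms] x r by simp
  then show False using P(2) n(1) r(1) unfolding D_def by blast
qed

theorem strongly_pi_regular_determined_by_prime_factors:
  "determined_by_prime_factors strongly_pi_regular"
proof -
  have factor: "has_property (strongly_pi_regular :: 'a ring \<Rightarrow> bool) (A Quot P) \<longleftrightarrow> strongly_pi_regular (A Quot P)"
    if "prime_ideal A P" for A :: "'a ring" and P
  proof -
    have P: "ideal P A" using that by (simp add: prime_ideal_def)
    obtain B :: "'a ring" where B: "ring B" "B \<simeq> A Quot P"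
      using factor_ring_has_copy[OF P] by auto
    have iso: "strongly_pi_regular C \<longleftrightarrow> strongly_pi_regular (A Quot P)"
      if "ring C" "C \<simeq> A Quot P" for C :: "'a ring"
      using strongly_pi_regular_iso[OF that(1) ideal.quotient_is_ring[OF P] that(2)] .
    show ?thesis
      unfolding has_property_def
    proof
      assume "\<exists>C :: 'a ring. ring C \<and> C \<simeq> A Quot P \<and> strongly_pi_regular C"
      then show "strongly_pi_regular (A Quot P)" using iso by blast
    next
      assume "strongly_pi_regular (A Quot P)"
      then show "\<exists>C :: 'a ring. ring C \<and> C \<simeq> A Quot P \<and> strongly_pi_regular C"
        using iso[OF B] B by blast
    qed
  qed
  show ?thesis
    unfolding determined_by_prime_factors_def
  proof (intro allI impI iffI)
    fix A :: "'a ring" and P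
    assume A: "ring A" "strongly_pi_regular A" and P: "prime_ideal A P"
    have "ideal P A" using P by (simp add: prime_ideal_def)
    from ring.strongly_pi_regular_quotient[OF A(1) this A(2)]
    show "has_property (strongly_pi_regular :: 'a ring \<Rightarrow> bool) (A Quot P)"
      unfolding factor[OF P] .
  next
    fix A :: "'a ring"
    assume A: "ring A" and "\<forall>P. prime_ideal A P \<longrightarrow>
      has_property (strongly_pi_regular :: 'a ring \<Rightarrow> bool) (A Quot P)"
    then show "strongly_pi_regular A"
      using factor by (intro ring.strongly_pi_regular_if_prime_quotients[OF A]) simp
  qed
qed

section \<open>Adjoining idempotents that are central modulo the prime radical\<close>

theorem theorem1p13:
  fixes T :: "'a ring" and R \<E> S :: "'a set"
  assumes "ring T"
    and "subring R T"
    and "\<E> \<noteq> {}"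
    and "\<E> \<subseteq> idempotents_central_mod_prime_radical T"
    and "S = generate_ring T (R \<union> \<E>)"
  shows "(\<forall>\<C> :: 'a ring \<Rightarrow> bool. iso_invariant \<C> \<longrightarrow> determined_by_prime_factors \<C> \<longrightarrow>
            (\<C> (T\<lparr>carrier := R\<rparr>) \<longleftrightarrow> \<C> (T\<lparr>carrier := S\<rparr>)))
       \<and> (strongly_pi_regular (T\<lparr>carrier := R\<rparr>) \<longleftrightarrow> strongly_pi_regular (T\<lparr>carrier := S\<rparr>))"
proof -
  interpret T: ring T by fact
  have gens: "R \<union> \<E> \<subseteq> carrier T"
    using subringE(1)[OF assms(2)] assms(4)
    unfolding idempotents_central_mod_prime_radical_def by blast
  have S: "subring S T" "R \<subseteq> S"
    using T.generate_ringE(1,2)[OF gens assms(5)] by simp_all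
  have S_ring: "ring (T\<lparr>carrier := S\<rparr>)" by (rule T.subring_is_ring[OF S(1)])
  have R: "subring R (T\<lparr>carrier := S\<rparr>)"
    using ring.ring_incl_imp_subring[OF S_ring] S(2) T.subring_is_ring[OF assms(2)] by simp
  have sum: "R <+>\<^bsub>T\<lparr>carrier := S\<rparr>\<^esub> K = carrier (T\<lparr>carrier := S\<rparr>)"
    if "prime_ideal (T\<lparr>carrier := S\<rparr>) K" for K
    using T.subring_eq_sum_with_prime[OF assms(2,4)] that assms(5)
    by (simp add: set_add_def')
  have main: "\<C> (T\<lparr>carrier := R\<rparr>) \<longleftrightarrow> \<C> (T\<lparr>carrier := S\<rparr>)"
    if "determined_by_prime_factors \<C>" for \<C> :: "'a ring \<Rightarrow> bool"
    using property_iff_of_sum_with_primes[OF S_ring R sum that] by simp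
  then show ?thesis using strongly_pi_regular_determined_by_prime_factors by blast
qed

end
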